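(* Let $m,p,q\ge 1$ be integers, let $\mathcal H$ be a complex Hilbert space (of finite or infinite dimension), and let $\mathbf A=(A_1,\dots,A_m)$ be an $m$-tuple of bounded self-adjoint operators on $\mathcal H$. Suppose $\dim\mathcal H\ge (pq(m+2)-1)(m+1)^2$. Then: (1) $\Lambda_{pq(m+2)}(\mathbf A)$ is non-empty. (2) $\Lambda_{p,q}(\mathbf A)$ is star-shaped, and $(c_1I_q,\dots,c_mI_q)$ is a star-center of $\Lambda_{p,q}(\mathbf A)$ for all $(c_1,\dots,c_m)\in\Lambda_{pq(m+2)}(\mathbf A)$. (3) For every integer $r\ge1$ and every real affine map $L:\mathbf H_q^m\to\mathbb R^r$, where $\mathbf H_q$ is the real vector space of $q\times q$ complex Hermitian matrices, the set $$\{L(B_1,\dots,B_m):(B_1,\dots,B_m)\in\Lambda_{p,q}(\mathbf A)\}$$ is star-shaped with star-center $L(c_1I_q,\dots,c_mI_q)$ for all $(c_1,\dots,c_m)\in\Lambda_{pq(m+2)}(\mathbf A)$.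
   Context: Let $\mathbf M_q$ be the space of $q\times q$ complex matrices. For bounded operators $\mathbf A=(A_1,\dots,A_m)$ on a complex Hilbert space $\mathcal H$ and positive integers $p,q$, the joint $(p,q)$-matricial range $\Lambda_{p,q}(\mathbf A)$ is the set of all $(B_1,\dots,B_m)\in\mathbf M_q^m$ for which there is a linear isometry $X:\mathbb C^p\otimes\mathbb C^q\to\mathcal H$ with $X^*A_jX=I_p\otimes B_j$ for all $j=1,\dots,m$ (the same $X$ for all $j$). (If the $A_j$ are self-adjoint, the $B_j$ are Hermitian.) For a positive integer $k$, the joint rank $k$-numerical range $\Lambda_k(\mathbf A)$ is the set of $(b_1,\dots,b_m)\in\mathbb C^m$ for which there is a linear isometry $X:\mathbb C^k\to\mathcal H$ with $X^*A_jX=b_jI_k$ for all $j$. A subset $S$ of a real or complex vector space is star-shaped if there is $s_0\in S$ with $ts_0+(1-t)s\in S$ for all $s\in S$ and $0\le t\le1$; such an $s_0$ is called a star-center of $S$. *)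

theory Defs
  imports "HOL-Analysis.Analysis"
begin

text \<open>A complex Hilbert space: the real inner product underlying the norm and the topology is the
  real part of the complex inner product, which is conjugate-linear in its first argument.
  Positive definiteness is inherited from \<^class>\<open>real_inner\<close>.\<close>

class complex_hilbert_space = real_inner + complete_space +
  fixes scaleC :: "complex \<Rightarrow> 'a \<Rightarrow> 'a" (infixr "*\<^sub>C" 75)
    and cinner :: "'a \<Rightarrow> 'a \<Rightarrow> complex"
  assumes scaleC_add_right: "c *\<^sub>C (x + y) = c *\<^sub>C x + c *\<^sub>C y"
    and scaleC_add_left: "(c + d) *\<^sub>C x = c *\<^sub>C x + d *\<^sub>C x"
    and scaleC_scaleC: "c *\<^sub>C d *\<^sub>C x = (c * d) *\<^sub>C x"
    and scaleC_of_real: "complex_of_real r *\<^sub>C x = r *\<^sub>R x"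
    and cinner_commute: "cinner x y = cnj (cinner y x)"
    and cinner_add_right: "cinner x (y + z) = cinner x y + cinner x z"
    and cinner_scaleC_right: "cinner x (c *\<^sub>C y) = c * cinner x y"
    and Re_cinner: "Re (cinner x y) = inner x y"

global_interpretation complex_vector:
  vector_space "scaleC :: complex \<Rightarrow> 'a \<Rightarrow> 'a :: complex_hilbert_space"
  defines cspan = complex_vector.span
    and cdim = complex_vector.dim
proof unfold_locales
  show "1 *\<^sub>C x = x" for x :: 'a
    using scaleC_of_real[of 1 x] by simp
qed (simp_all add: scaleC_add_right scaleC_add_left scaleC_scaleC)

text \<open>Since \<^const>\<open>cdim\<close> is \<open>0\<close> on spaces without a finite basis, these are treated separately.\<close>

definition cdim_at_least :: "'h::complex_hilbert_space itself \<Rightarrow> nat \<Rightarrow> bool" where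
  "cdim_at_least _ n \<longleftrightarrow>
     ((\<exists>S::'h set. finite S \<and> cspan S = UNIV) \<longrightarrow> n \<le> cdim (UNIV :: 'h set))"

instantiation complex :: complex_hilbert_space
begin

definition scaleC_complex :: "complex \<Rightarrow> complex \<Rightarrow> complex" where
  "scaleC_complex c x = c * x"

definition cinner_complex :: "complex \<Rightarrow> complex \<Rightarrow> complex" where
  "cinner_complex x y = cnj x * y"

instance
  by standard
    (simp_all add: scaleC_complex_def cinner_complex_def algebra_simps scaleR_conv_of_real
      inner_complex_def)

end

instantiation vec :: (complex_hilbert_space, finite) complex_hilbert_space
begin

definition scaleC_vec :: "complex \<Rightarrow> 'a^'b \<Rightarrow> 'a^'b" where
  "scaleC_vec c x = (\<chi> i. c *\<^sub>C x $ i)"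

definition cinner_vec :: "'a^'b \<Rightarrow> 'a^'b \<Rightarrow> complex" where
  "cinner_vec x y = (\<Sum>i\<in>UNIV. cinner (x $ i) (y $ i))"

instance
proof
  show "cinner x y = cnj (cinner y x)" for x y :: "'a^'b"
    unfolding cinner_vec_def cnj_sum by (intro sum.cong refl cinner_commute)
qed (simp_all add: scaleC_vec_def cinner_vec_def vec_eq_iff scaleC_add_right scaleC_add_left
      scaleC_scaleC scaleC_of_real cinner_add_right cinner_scaleC_right Re_cinner
      sum.distrib sum_distrib_left inner_vec_def)

end

abbreviation clinear :: "('a::complex_hilbert_space \<Rightarrow> 'b::complex_hilbert_space) \<Rightarrow> bool" where
  "clinear \<equiv> Vector_Spaces.linear scaleC scaleC"

definition bounded_clinear :: "('a::complex_hilbert_space \<Rightarrow> 'b::complex_hilbert_space) \<Rightarrow> bool" where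
  "bounded_clinear T \<longleftrightarrow> clinear T \<and> (\<exists>K. \<forall>x. norm (T x) \<le> norm x * K)"

definition clinear_isometry :: "('a::complex_hilbert_space \<Rightarrow> 'b::complex_hilbert_space) \<Rightarrow> bool" where
  "clinear_isometry X \<longleftrightarrow> clinear X \<and> (\<forall>v. norm (X v) = norm v)"

definition is_cadjoint ::
    "('a::complex_hilbert_space \<Rightarrow> 'b::complex_hilbert_space) \<Rightarrow> ('b \<Rightarrow> 'a) \<Rightarrow> bool" where
  "is_cadjoint T S \<longleftrightarrow> (\<forall>x y. cinner (T x) y = cinner x (S y))"

definition cadjoint ::
    "('a::complex_hilbert_space \<Rightarrow> 'b::complex_hilbert_space) \<Rightarrow> 'b \<Rightarrow> 'a" where
  "cadjoint T = (SOME S. is_cadjoint T S)"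

lemma is_cadjoint_unique:
  assumes "is_cadjoint T S"
  shows "cadjoint T = S"
proof -
  have "is_cadjoint T (cadjoint T)"
    unfolding cadjoint_def by (rule someI[of "is_cadjoint T", OF assms])
  with assms have eq: "cinner x (cadjoint T y) = cinner x (S y)" for x y
    by (simp add: is_cadjoint_def)
  have "inner x (cadjoint T y) = inner x (S y)" for x y
    using eq[of x y] by (metis Re_cinner)
  then show ?thesis
    by (metis ext inner_commute vector_eq_ldot)
qed

lemma is_cadjoint_cadjoint:
  fixes T :: "complex^'n \<Rightarrow> 'h::complex_hilbert_space"
  assumes "clinear T"
  shows "is_cadjoint T (cadjoint T)"
proof -
  interpret T: Vector_Spaces.linear scaleC scaleC T by fact
  have "is_cadjoint T (\<lambda>y. \<chi> i. cinner (T (axis i 1)) y)"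
    unfolding is_cadjoint_def
  proof (intro allI)
    fix x :: "complex^'n" and y :: 'h
    have add0: "cinner y 0 = 0"
      using cinner_add_right[of y 0 0] by simp
    have sum: "cinner y (\<Sum>i\<in>I. f i) = (\<Sum>i\<in>I. cinner y (f i))" if "finite I"
      for I :: "'n set" and f :: "'n \<Rightarrow> 'h"
      using that by induction (simp_all add: add0 cinner_add_right)
    have x: "x = (\<Sum>i\<in>UNIV. x $ i *\<^sub>C axis i 1)"
      by (simp add: vec_eq_iff scaleC_vec_def scaleC_complex_def axis_def if_distrib
          cong: if_cong)
    have "cinner y (T x) = (\<Sum>i\<in>UNIV. x $ i * cinner y (T (axis i 1)))"
      by (subst x) (simp add: T.sum T.scale sum cinner_scaleC_right)
    then have "cinner (T x) y = (\<Sum>i\<in>UNIV. cnj (x $ i) * cnj (cinner y (T (axis i 1))))"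
      by (subst cinner_commute) (simp add: cnj_sum)
    also have "\<dots> = (\<Sum>i\<in>UNIV. cnj (x $ i) * cinner (T (axis i 1)) y)"
      by (intro sum.cong refl) (metis cinner_commute)
    finally show "cinner (T x) y = cinner x (\<chi> i. cinner (T (axis i 1)) y)"
      by (simp add: cinner_vec_def cinner_complex_def)
  qed
  then show ?thesis
    using is_cadjoint_unique by metis
qed

definition selfadjoint :: "('h::complex_hilbert_space \<Rightarrow> 'h) \<Rightarrow> bool" where
  "selfadjoint T \<longleftrightarrow> bounded_clinear T \<and> is_cadjoint T T"

definition hermitian :: "complex^'n^'n \<Rightarrow> bool" where
  "hermitian M \<longleftrightarrow> (\<forall>i j. M $ i $ j = cnj (M $ j $ i))"

text \<open>Kronecker product. The space \<open>\<complex>\<^sup>p \<otimes> \<complex>\<^sup>q\<close> is \<open>complex^('p \<times> 'q)\<close>, with the standard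
  basis \<open>e\<^sub>i \<otimes> e\<^sub>j\<close> indexed by the pairs \<open>(i, j)\<close>.\<close>

definition kronecker ::
    "'a::times^'n1^'m1 \<Rightarrow> 'a^'n2^'m2 \<Rightarrow> 'a^('n1 \<times> 'n2)^('m1 \<times> 'm2)" (infixl "\<otimes>\<^sub>K" 70) where
  "M \<otimes>\<^sub>K N = (\<chi> r s. M $ fst r $ fst s * N $ snd r $ snd s)"

text \<open>Tuples indexed by \<open>{1..m}\<close> are indexed by a type \<open>'m\<close> with \<open>m\<close> elements, and similarly for the
  other dimensions. Matrix tuples and scalar tuples are of \<^type>\<open>vec\<close> type, so that they form
  real vector spaces. The dimension \<open>p\<close> (resp. \<open>k\<close>) is passed as a type argument.\<close>

definition matricial_range ::
    "'p::finite itself \<Rightarrow> ('m::finite \<Rightarrow> 'h::complex_hilbert_space \<Rightarrow> 'h) \<Rightarrow> (complex^'q^'q^'m) set" where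
  "matricial_range _ A =
     {B. \<exists>X :: complex^('p \<times> 'q) \<Rightarrow> 'h. clinear_isometry X \<and>
           (\<forall>j. cadjoint X \<circ> A j \<circ> X = (*v) ((mat 1 :: complex^'p^'p) \<otimes>\<^sub>K B $ j))}"

definition rank_numerical_range ::
    "'k::finite itself \<Rightarrow> ('m::finite \<Rightarrow> 'h::complex_hilbert_space \<Rightarrow> 'h) \<Rightarrow> (complex^'m) set" where
  "rank_numerical_range _ A =
     {b. \<exists>X :: complex^'k \<Rightarrow> 'h. clinear_isometry X \<and>
           (\<forall>j. cadjoint X \<circ> A j \<circ> X = (*v) (mat (b $ j)))}"

definition scalar_tuple :: "complex^'m \<Rightarrow> complex^'q^'q^'m" where
  "scalar_tuple c = (\<chi> j. mat (c $ j))"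

text \<open>The library's \<^const>\<open>starlike\<close> says that some star-center exists.\<close>

definition star_center :: "'v::real_vector set \<Rightarrow> 'v \<Rightarrow> bool" where
  "star_center S a \<longleftrightarrow> a \<in> S \<and> (\<forall>x\<in>S. closed_segment a x \<subseteq> S)"

definition affine_map_on :: "'v::real_vector set \<Rightarrow> ('v \<Rightarrow> 'w::real_vector) \<Rightarrow> bool" where
  "affine_map_on S L \<longleftrightarrow>
     (\<forall>x\<in>S. \<forall>y\<in>S. \<forall>t::real. L ((1 - t) *\<^sub>R x + t *\<^sub>R y) = (1 - t) *\<^sub>R L x + t *\<^sub>R L y)"

end

(*
Star-shapedness: let X realise B in the (p,q)-range and let Y realise c in the rank-k range with
k = pq(m+2). Orthogonality to ran X and to all A_j (ran X) imposes at most pq(m+1) conditions, so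
ran Y contains a pq-dimensional subspace satisfying them; with an isometry Z onto it, the isometry
sqrt(1-t) Z + sqrt(t) X has compressions (1-t) c_j I + t (I (x) B_j).

Non-emptiness: choose unit vectors x_0, x_1, ..., x_M with M = (k-1)(m+1) greedily, x_i being
orthogonal to x_l and to A_j x_l for all l < i. In finite dimension x_0 is taken to be an
eigenvector of one A_j; this saves exactly the one dimension needed. The A_j are then diagonal on
the x_i, and Tverberg's theorem, applied to the M + 1 diagonals in R^m, groups the x_i into k
blocks whose suitably weighted sums all have the same diagonal. Tverberg's theorem is obtained by
Sarkaria's tensor trick from Barany's colourful Caratheodory theorem.
*)
theory Submission
  imports Defs "HOL-Computational_Algebra.Fundamental_Theorem_Algebra"
begin

section \<open>Orthonormal families and compressions\<close>

lemma cinner_add_left: "cinner (x + y) z = cinner x z + cinner y z"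
  by (metis cinner_add_right cinner_commute complex_cnj_add)

lemma cinner_scaleC_left: "cinner (c *\<^sub>C x) y = cnj c * cinner x y"
  by (metis cinner_commute cinner_scaleC_right complex_cnj_mult)

text \<open>With \<open>Re_cinner\<close> this recovers \<open>cinner\<close> from the real inner
  product, so a complex linear map preserving the latter preserves the former.\<close>

lemma Im_cinner: "Im (cinner x y) = - inner x (\<i> *\<^sub>C y)"
  by (simp add: cinner_scaleC_right flip: Re_cinner)

lemma cinner_zero_right [simp]: "cinner x 0 = 0"
  using cinner_add_right[of x 0 0] by simp

lemma cinner_zero_left [simp]: "cinner 0 x = 0"
  using cinner_add_left[of 0 0 x] by simp

lemma cinner_diff_right: "cinner x (y - z) = cinner x y - cinner x z"
  by (metis add_diff_cancel_right' cinner_add_right diff_add_cancel)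

lemma cinner_sum_right: "cinner x (\<Sum>i\<in>I. f i) = (\<Sum>i\<in>I. cinner x (f i))"
  by (induction I rule: infinite_finite_induct) (simp_all add: cinner_add_right)

lemma cinner_sum_left: "cinner (\<Sum>i\<in>I. f i) x = (\<Sum>i\<in>I. cinner (f i) x)"
  by (induction I rule: infinite_finite_induct) (simp_all add: cinner_add_left)

lemma cinner_self: "cinner x x = of_real ((norm x)\<^sup>2)"
proof -
  have "Im (cinner x x) = 0"
    using arg_cong[OF cinner_commute[of x x], of Im] by simp
  then show ?thesis
    by (simp add: complex_eq_iff Re_cinner power2_norm_eq_inner)
qed

lemma cinner_self_eq_0_iff [simp]: "cinner x x = 0 \<longleftrightarrow> x = 0"
  by (simp add: cinner_self)

lemma cinner_eq_0_sym: "cinner x y = 0 \<longleftrightarrow> cinner y x = 0"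
  by (metis cinner_commute complex_cnj_zero)

section \<open>Orthogonal projection onto finite spans\<close>

lemma cinner_span_eq_0:
  assumes "g \<in> cspan F" and "\<And>f. f \<in> F \<Longrightarrow> cinner f x = 0"
  shows "cinner g x = 0"
  using assms(1)
  by (induction rule: complex_vector.span_induct_alt)
    (simp_all add: assms(2) cinner_add_left cinner_scaleC_left)

text \<open>Gram-Schmidt: project \<open>a\<close> and \<open>y\<close> onto the span of
  \<open>F\<close>, then correct the projection of \<open>y\<close> along the residual of
  \<open>a\<close>.\<close>

lemma orthogonal_projection_ex:
  assumes "finite F"
  shows "\<exists>z \<in> cspan F. \<forall>f \<in> F. cinner f (y - z) = 0"
  using assms
proof (induction F arbitrary: y)
  case empty
  then show ?case
    by auto
next
  case (insert a F)
  obtain za where za: "za \<in> cspan F" "\<forall>f\<in>F. cinner f (a - za) = 0"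
    using insert.IH by blast
  obtain z0 where z0: "z0 \<in> cspan F" "\<forall>f\<in>F. cinner f (y - z0) = 0"
    using insert.IH by blast
  define a' where "a' = a - za"
  \<comment> \<open>If \<open>a'\<close> is \<open>0\<close>, the quotient is \<open>0\<close> by
    convention and orthogonality to \<open>a'\<close> is trivial.\<close>
  define c where "c = cinner a' (y - z0) / cinner a' a'"
  define z where "z = z0 + c *\<^sub>C a'"
  have sub: "cspan F \<subseteq> cspan (insert a F)"
    by (rule complex_vector.span_mono) auto
  have a'_in: "a' \<in> cspan (insert a F)"
    unfolding a'_def
  proof (rule complex_vector.span_diff)
    show "a \<in> cspan (insert a F)"
      by (simp add: complex_vector.span_base)
    show "za \<in> cspan (insert a F)"
      using za(1) sub by blast
  qed
  have z_in: "z \<in> cspan (insert a F)"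
    unfolding z_def using z0(1) sub a'_in
    by (intro complex_vector.span_add complex_vector.span_scale) auto
  have *: "cinner x (y - z) = cinner x (y - z0) - c * cinner x a'" for x
    by (simp add: z_def cinner_diff_right cinner_add_right cinner_scaleC_right)
  have orthF: "cinner f (y - z) = 0" if "f \<in> F" for f
    using that z0(2) za(2) by (simp add: * a'_def)
  have "cinner a' (y - z) = 0"
    by (simp add: * c_def)
  moreover have "cinner za (y - z) = 0"
    using cinner_span_eq_0[OF za(1)] orthF by blast
  ultimately have "cinner a (y - z) = 0"
    using cinner_add_left[of a' za "y - z"] by (simp add: a'_def)
  with orthF z_in show ?case
    by blast
qed

lemma scaleR_eq_scaleC: "r *\<^sub>R x = complex_of_real r *\<^sub>C x"
  by (simp add: scaleC_of_real)

lemma normalize_orthogonal: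
  assumes "x \<in> cspan S" "x \<noteq> 0" "\<And>f. f \<in> F \<Longrightarrow> cinner f x = 0"
  shows "\<exists>z \<in> cspan S. norm z = 1 \<and> (\<forall>f \<in> F. cinner f z = 0)"
proof (intro bexI conjI ballI)
  show "complex_of_real (inverse (norm x)) *\<^sub>C x \<in> cspan S"
    by (intro complex_vector.span_scale assms)
  show "norm (complex_of_real (inverse (norm x)) *\<^sub>C x) = 1"
    unfolding scaleC_of_real using assms(2) by simp
qed (simp add: assms(3) cinner_scaleC_right)

lemma orthogonal_unit_vector_ex:
  assumes "finite F" "cspan F \<noteq> UNIV"
  shows "\<exists>z. norm z = 1 \<and> (\<forall>f \<in> F. cinner f z = 0)"
proof -
  obtain y where y: "y \<notin> cspan F"
    using assms(2) by auto
  obtain z where z: "z \<in> cspan F" "\<forall>f\<in>F. cinner f (y - z) = 0"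
    using orthogonal_projection_ex[OF assms(1)] by blast
  have "y - z \<in> cspan UNIV" "y - z \<noteq> 0"
    using y z(1) by (auto simp: complex_vector.span_base)
  from normalize_orthogonal[OF this] z(2) show ?thesis
    by blast
qed

text \<open>On \<open>cspan S\<close> only the projections \<open>P f\<close> matter. They are fewer
  than \<open>card S\<close>, so some \<open>s\<close> in \<open>S\<close> lies outside their span,
  and its normalized residual is the vector sought.\<close>

lemma orthogonal_unit_vector_in_span_ex:
  assumes "finite F" "finite S" "complex_vector.independent S" "card F < card S"
  shows "\<exists>z \<in> cspan S. norm z = 1 \<and> (\<forall>f \<in> F. cinner f z = 0)"
proof -
  obtain P where P: "\<And>f. P f \<in> cspan S" "\<And>f s. s \<in> S \<Longrightarrow> cinner s (f - P f) = 0"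
    using orthogonal_projection_ex[OF assms(2)] by metis
  have "card (P ` F) < card S"
    using assms(1,4) card_image_le le_less_trans by blast
  then have "\<not> S \<subseteq> cspan (P ` F)"
    using complex_vector.independent_span_bound[of "P ` F" S] assms by auto
  then obtain s where s: "s \<in> S" "s \<notin> cspan (P ` F)"
    by blast
  obtain z where z: "z \<in> cspan (P ` F)" "\<forall>f\<in>P ` F. cinner f (s - z) = 0"
    using orthogonal_projection_ex[of "P ` F"] assms(1) by blast
  have "cspan (P ` F) \<subseteq> cspan S"
    using P(1) by (intro complex_vector.span_minimal) auto
  then have in_span: "s - z \<in> cspan S"
    using z(1) s(1) by (auto intro: complex_vector.span_diff complex_vector.span_base)
  have "cinner f (s - z) = 0" if "f \<in> F" for f
  proof -
    have "cinner (s - z) (f - P f) = 0"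
      by (rule cinner_span_eq_0[OF in_span P(2)])
    then have "cinner (f - P f) (s - z) = 0"
      using cinner_eq_0_sym by blast
    then show ?thesis
      using z(2) that cinner_add_left[of "f - P f" "P f" "s - z"] by simp
  qed
  moreover have "s - z \<noteq> 0"
    using s(2) z(1) by auto
  ultimately show ?thesis
    using normalize_orthogonal[OF in_span] by blast
qed

section \<open>Orthonormal families\<close>

definition orthonormal_family :: "('i \<Rightarrow> 'h::complex_hilbert_space) \<Rightarrow> bool" where
  "orthonormal_family y \<longleftrightarrow> (\<forall>a b. cinner (y a) (y b) = of_bool (a = b))"

lemma orthonormal_independent:
  assumes "orthonormal_family y"
  shows "inj y" "complex_vector.independent (range y)"
proof -
  have y: "cinner (y a) (y b) = of_bool (a = b)" for a b
    using assms by (simp add: orthonormal_family_def)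
  show "inj y"
    by (rule injI) (metis y of_bool_eq_1_iff)
  show "complex_vector.independent (range y)"
    unfolding complex_vector.dependent_def
  proof
    assume "\<exists>x\<in>range y. x \<in> cspan (range y - {x})"
    then obtain a where "y a \<in> cspan (range y - {y a})"
      by auto
    then have "cinner (y a) (y a) = 0"
      by (rule cinner_span_eq_0) (auto simp: y)
    then show False
      by (simp add: y)
  qed
qed

text \<open>Vectors are added one at a time. Each must be orthogonal to \<open>F\<close> and to
  those already found, which is fewer than \<open>card S\<close> conditions.\<close>

lemma orthonormal_family_in_span_ex:
  fixes S F :: "'h::complex_hilbert_space set"
  assumes "finite F" "finite S" "complex_vector.independent S"
    and "card F + CARD('n::finite) \<le> card S"
  obtains z :: "'n::finite \<Rightarrow> 'h" where "orthonormal_family z" "\<And>a. z a \<in> cspan S"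
    "\<And>a f. f \<in> F \<Longrightarrow> cinner f (z a) = 0"
proof -
  have "\<exists>z :: 'n \<Rightarrow> 'h. (\<forall>a\<in>I. z a \<in> cspan S \<and> (\<forall>f\<in>F. cinner f (z a) = 0))
      \<and> (\<forall>a\<in>I. \<forall>b\<in>I. cinner (z a) (z b) = of_bool (a = b))" for I
    using finite[of I]
  proof (induction I)
    case empty
    then show ?case by simp
  next
    case (insert i I)
    then obtain z :: "'n \<Rightarrow> 'h" where
      z: "\<And>a. a \<in> I \<Longrightarrow> z a \<in> cspan S" "\<And>a f. a \<in> I \<Longrightarrow> f \<in> F \<Longrightarrow> cinner f (z a) = 0"
        "\<And>a b. a \<in> I \<Longrightarrow> b \<in> I \<Longrightarrow> cinner (z a) (z b) = of_bool (a = b)"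
      by metis
    have "card (F \<union> z ` I) \<le> card F + card I"
      by (meson card_Un_le card_image_le finite nat_add_left_cancel_le order_trans)
    moreover have "card I < CARD('n)"
      using insert.hyps(2) by (intro psubset_card_mono) auto
    ultimately have "card (F \<union> z ` I) < card S"
      using assms(4) by simp
    then obtain w where w: "w \<in> cspan S" "norm w = 1" "\<And>f. f \<in> F \<union> z ` I \<Longrightarrow> cinner f w = 0"
      using orthogonal_unit_vector_in_span_ex[of "F \<union> z ` I" S] assms by auto
    have w': "cinner w (z a) = 0" if "a \<in> I" for a
      using w(3)[of "z a"] that cinner_eq_0_sym by auto
    show ?case
      using insert.hyps(2) z w w' by (intro exI[of _ "z(i := w)"]) (auto simp: cinner_self)
  qed
  from this[of UNIV] show ?thesis
    using that by (auto simp: orthonormal_family_def)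
qed

section \<open>Compressions described by orthonormal families\<close>

lemma selfadjoint_clinear: "selfadjoint T \<Longrightarrow> clinear T"
  by (simp add: selfadjoint_def bounded_clinear_def)

lemma selfadjoint_cinner: "selfadjoint T \<Longrightarrow> cinner (T x) y = cinner x (T y)"
  by (simp add: selfadjoint_def is_cadjoint_def)

lemma clinear_sum_scale:
  assumes "clinear T"
  shows "T (\<Sum>i\<in>I. c i *\<^sub>C x i) = (\<Sum>i\<in>I. c i *\<^sub>C T (x i))"
proof -
  interpret T: Vector_Spaces.linear scaleC scaleC T by fact
  show ?thesis by (simp add: T.sum T.scale)
qed

lemma cinner_axis: "cinner (axis a 1 :: complex^'n) v = v $ a"
  by (simp add: cinner_vec_def cinner_complex_def axis_def if_distrib if_distribR cong: if_cong)

lemma cinner_sum_sum: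
  assumes "\<And>a b. a \<in> I \<Longrightarrow> b \<in> J \<Longrightarrow> cinner (y a) (z b) = G a b"
  shows "cinner (\<Sum>a\<in>I. v a *\<^sub>C y a) (\<Sum>b\<in>J. w b *\<^sub>C z b)
    = (\<Sum>a\<in>I. cnj (v a) * (\<Sum>b\<in>J. G a b * w b))"
  by (subst cinner_sum_left)
    (simp add: cinner_scaleC_left cinner_sum_right cinner_scaleC_right assms sum_distrib_left
      mult_ac)

text \<open>The \<open>y a\<close> are the images of the standard basis under \<open>X\<close>, and
  \<open>cinner (y a) (A j (y b))\<close> are the entries of the compression. Both kinds of range
  thus become statements about orthonormal families, free of isometries and their adjoints.\<close>

lemma compression_iff:
  fixes A :: "'m \<Rightarrow> 'h::complex_hilbert_space \<Rightarrow> 'h" and M :: "'m \<Rightarrow> complex^'n^'n"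
  assumes "\<And>j. clinear (A j)"
  shows "(\<exists>X. clinear_isometry X \<and> (\<forall>j. cadjoint X \<circ> A j \<circ> X = (*v) (M j))) \<longleftrightarrow>
    (\<exists>y. orthonormal_family y \<and> (\<forall>j a b. cinner (y a) (A j (y b)) = M j $ a $ b))"
    (is "?L \<longleftrightarrow> ?R")
proof
  assume ?L
  then obtain X where X: "clinear X" "\<And>v. norm (X v) = norm v"
    and XA: "\<And>j v. cadjoint X (A j (X v)) = M j *v v"
    by (auto simp: clinear_isometry_def fun_eq_iff)
  have adj: "cinner (X v) u = cinner v (cadjoint X u)" for u v
    using is_cadjoint_cadjoint[OF X(1)] by (simp add: is_cadjoint_def)
  interpret X: Vector_Spaces.linear scaleC scaleC X by fact
  define y where "y a = X (axis a 1)" for a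
  \<comment> \<open>Polarization: a linear map preserving norms preserves the real inner
    product.\<close>
  have inner: "inner (X v) (X w) = inner v w" for v w
  proof -
    have "(norm (X v + X w))\<^sup>2 = (norm (v + w))\<^sup>2"
      by (simp add: X(2) flip: X.add)
    then show ?thesis
      using X(2)[of v] X(2)[of w] by (simp add: power2_norm_eq_inner norm_eq inner_add inner_commute)
  qed
  have cinner: "cinner (X v) (X w) = cinner v w" for v w
    by (simp add: complex_eq_iff Re_cinner Im_cinner inner flip: X.scale)
  have "orthonormal_family y"
    unfolding orthonormal_family_def y_def cinner cinner_axis by (simp add: axis_def)
  moreover have "cinner (y a) (A j (y b)) = M j $ a $ b" for j a b
    unfolding y_def adj XA cinner_axis
    by (simp add: matrix_vector_mult_def axis_def if_distrib cong: if_cong)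
  ultimately show ?R
    by blast
next
  assume ?R
  then obtain y where y: "\<And>a b. cinner (y a) (y b) = of_bool (a = b)"
    and yA: "\<And>j a b. cinner (y a) (A j (y b)) = M j $ a $ b"
    by (auto simp: orthonormal_family_def)
  define X where "X v = (\<Sum>a\<in>UNIV. (v $ a) *\<^sub>C y a)" for v :: "complex^'n"
  have lin: "clinear X"
    by unfold_locales
      (simp_all add: X_def scaleC_vec_def scaleC_complex_def scaleC_add_left sum.distrib
        scaleC_scaleC complex_vector.scale_sum_right)
  have cinner: "cinner (X v) (X w) = cinner v w" for v w
    unfolding X_def cinner_sum_sum[OF y]
    by (simp add: cinner_vec_def cinner_complex_def of_bool_def if_distrib[of "\<lambda>x. x * _"]
        cong: if_cong)
  have "cinner (X v) (X v) = cinner v v" for v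
    by (rule cinner)
  then have norm: "norm (X v) = norm v" for v
    by (simp only: cinner_self of_real_eq_iff) simp
  have "cadjoint X (A j (X w)) = M j *v w" for j w
  proof -
    have "cadjoint X (A j (X w)) $ a = (M j *v w) $ a" for a
    proof -
      have "cadjoint X (A j (X w)) $ a = cinner (X (axis a 1)) (A j (X w))"
        using is_cadjoint_cadjoint[OF lin] by (simp add: is_cadjoint_def cinner_axis)
      also have "\<dots> = cinner (axis a 1) (M j *v w)"
        unfolding X_def clinear_sum_scale[OF assms] cinner_sum_sum[OF yA]
        by (simp add: cinner_vec_def cinner_complex_def matrix_vector_mult_def)
      finally show ?thesis
        by (simp add: cinner_axis)
    qed
    then show ?thesis
      by (simp add: vec_eq_iff)
  qed
  then show ?L
    using lin norm by (auto simp: clinear_isometry_def fun_eq_iff)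
qed

lemma matricial_range_iff:
  fixes A :: "'m::finite \<Rightarrow> 'h::complex_hilbert_space \<Rightarrow> 'h" and B :: "complex^'q^'q^'m"
  assumes "\<And>j. clinear (A j)"
  shows "B \<in> matricial_range TYPE('p::finite) A \<longleftrightarrow>
    (\<exists>y :: 'p \<times> 'q \<Rightarrow> 'h. orthonormal_family y \<and>
      (\<forall>j a b. cinner (y a) (A j (y b)) = of_bool (fst a = fst b) * B $ j $ snd a $ snd b))"
  unfolding matricial_range_def mem_Collect_eq
    compression_iff[where M = "\<lambda>j. (mat 1 :: complex^'p^'p) \<otimes>\<^sub>K B $ j", OF assms]
  by (simp add: kronecker_def mat_def of_bool_def)

lemma rank_numerical_range_iff:
  fixes A :: "'m::finite \<Rightarrow> 'h::complex_hilbert_space \<Rightarrow> 'h"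
  assumes "\<And>j. clinear (A j)"
  shows "c \<in> rank_numerical_range TYPE('k::finite) A \<longleftrightarrow>
    (\<exists>y :: 'k \<Rightarrow> 'h. orthonormal_family y \<and>
      (\<forall>j a b. cinner (y a) (A j (y b)) = of_bool (a = b) * c $ j))"
  unfolding rank_numerical_range_def mem_Collect_eq
    compression_iff[where M = "\<lambda>j. mat (c $ j) :: complex^'k^'k", OF assms]
  by (simp add: mat_def of_bool_def if_distrib if_distribR cong: if_cong)

section \<open>Tverberg's theorem\<close>

text \<open>\<open>f\<close> need not be injective: the weights sit on a set \<open>J\<close> of
  representatives and are \<open>0\<close> elsewhere.\<close>

lemma convex_hull_image_weights:
  assumes "finite I" "x \<in> convex hull (f ` I)"
  obtains w where "\<And>i. i \<in> I \<Longrightarrow> 0 \<le> w i" "sum w I = 1" "(\<Sum>i\<in>I. w i *\<^sub>R f i) = x"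
proof -
  obtain J where J: "J \<subseteq> I" "inj_on f J" "f ` I = f ` J"
    using subset_image_inj[of "f ` I" f I] by auto
  obtain u where u: "\<And>y. y \<in> f ` J \<Longrightarrow> 0 \<le> u y" "sum u (f ` J) = 1"
      "(\<Sum>y\<in>f ` J. u y *\<^sub>R y) = x"
    using assms unfolding J(3) by (auto simp: convex_hull_finite finite_subset[OF J(1)])
  define w where "w i = (if i \<in> J then u (f i) else 0)" for i
  have "sum w I = sum w J" "(\<Sum>i\<in>I. w i *\<^sub>R f i) = (\<Sum>i\<in>J. w i *\<^sub>R f i)"
    by (rule sum.mono_neutral_right; use assms(1) J(1) in \<open>auto simp: w_def\<close>)+
  then show ?thesis
    using u that[of w] by (auto simp: w_def sum.reindex[OF J(2)])
qed

text \<open>The bound is on the dimension spanned by the colours, not on the ambient dimension,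
  because Sarkaria's vectors all lie in a proper subspace.\<close>

lemma colourful_caratheodory:
  fixes C :: "'i \<Rightarrow> 'a::euclidean_space set"
  assumes I: "finite I"
    and C: "\<And>i. i \<in> I \<Longrightarrow> finite (C i)" "\<And>i. i \<in> I \<Longrightarrow> 0 \<in> convex hull (C i)"
    and dim: "dim (\<Union>i\<in>I. C i) < card I"
  obtains c where "\<And>i. i \<in> I \<Longrightarrow> c i \<in> C i" "0 \<in> convex hull (c ` I)"
proof -
  define E where "E = PiE I C"
  \<comment> \<open>Among all colourful choices take one whose hull is closest to \<open>0\<close>. Were the nearest point \<open>p\<close>
    not \<open>0\<close>, it would lie in the hull of fewer than \<open>card I\<close> of the chosen points, and an unused
    colour could be exchanged to get closer.\<close>
  define d where "d c = infdist 0 (convex hull (c ` I))" for c :: "'i \<Rightarrow> 'a"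
  have C_ne: "C i \<noteq> {}" if "i \<in> I" for i
    using C(2)[OF that] by auto
  have "finite E" "E \<noteq> {}"
    using I C(1) C_ne by (auto simp: E_def PiE_eq_empty_iff intro: finite_PiE)
  then obtain c where c: "c \<in> E" and min: "\<And>c'. c' \<in> E \<Longrightarrow> d c \<le> d c'"
    using ex_min_if_finite[of "d ` E"] by (auto simp: not_less)
  define K where "K = convex hull (c ` I)"
  have K: "convex K" "compact K" "closed K"
    using I by (auto simp: K_def intro: compact_imp_closed finite_imp_compact_convex_hull)
  have "I \<noteq> {}"
    using dim by auto
  then have "K \<noteq> {}"
    by (simp add: K_def)
  define p where "p = closest_point K 0"
  have p: "p \<in> K" and p_min: "\<And>y. y \<in> K \<Longrightarrow> norm p \<le> norm y"
    using closest_point_exists[OF K(3) \<open>K \<noteq> {}\<close>, of 0] by (auto simp: p_def)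
  have d_c: "d c = norm p"
    using infdist_eq_setdist[of 0 K] setdist_closest_point[OF K(3) \<open>K \<noteq> {}\<close>, of 0]
    by (simp add: d_def K_def p_def)
  have "p = 0"
  proof (rule ccontr)
    assume "p \<noteq> 0"
    then have pp: "inner p p > 0"
      by simp
    have supp: "inner p x \<ge> inner p p" if "x \<in> K" for x
      using closest_point_dot[OF K(1,3) that, of 0] by (simp add: inner_diff_right flip: p_def)
    \<comment> \<open>The hyperplane through \<open>p\<close> normal to \<open>p\<close> supports
      \<open>K\<close>, so it cuts out a face, which is the hull of some of the chosen
      points.\<close>
    obtain S' where S': "S' \<subseteq> c ` I" "K \<inter> {x. inner p x = inner p p} = convex hull S'"
      using face_of_convex_hull_subset[of "c ` I"]
        face_of_Int_supporting_hyperplane_ge[OF K(1) supp] I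
      unfolding K_def by (metis finite_imageI finite_imp_compact)
    have hyper: "affine hull S' \<subseteq> {x. inner p x = inner p p}"
      using S'(2) hull_subset[of S' convex] by (intro hull_minimal affine_hyperplane) auto
    then have "0 \<notin> affine hull S'"
      using pp by auto
    \<comment> \<open>As \<open>0\<close> is off the affine hull, adjoining it raises the dimension
      by one. This brings the number of points in Caratheodory's theorem below
      \<open>card I\<close>.\<close>
    then have "aff_dim S' + 1 = int (dim (insert 0 S'))"
      using aff_dim_insert[of 0 S'] aff_dim_zero[of "insert 0 S'"]
      by (simp add: hull_inc)
    also have "\<dots> \<le> int (dim (\<Union>i\<in>I. C i))"
    proof -
      have "S' \<subseteq> (\<Union>i\<in>I. C i)"
        using S'(1) c by (auto simp: E_def PiE_def Pi_def)
      then show ?thesis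
        using dim_subset[of S' "\<Union>i\<in>I. C i"] by (metis dim_span of_nat_le_iff span_insert_0)
    qed
    finally have small: "aff_dim S' + 1 < card I"
      using dim by simp
    have "p \<in> convex hull S'"
      using p S'(2) by auto
    then obtain S'' where S'': "S'' \<subseteq> S'" "card S'' \<le> aff_dim S' + 1" "p \<in> convex hull S''"
      by (subst (asm) caratheodory_aff_dim) auto
    obtain J where J: "J \<subseteq> I" "inj_on c J" "S'' = c ` J"
      using S''(1) S'(1) subset_image_inj[of S'' c I] by auto
    have "card J < card I"
      using S''(2) small J by (simp add: card_image)
    then obtain i where i: "i \<in> I" "i \<notin> J"
      using J(1) by (metis card_mono finite_subset I leD subsetI)
    have "\<exists>x \<in> C i. inner p x \<le> 0"
    proof (rule ccontr)
      assume "\<not> ?thesis"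
      then have "convex hull (C i) \<subseteq> {x. inner p x > 0}"
        by (intro hull_minimal convex_halfspace_gt) auto
      then show False
        using C(2)[OF i(1)] by auto
    qed
    then obtain x where x: "x \<in> C i" "inner p x \<le> 0"
      by blast
    define c' where "c' = c(i := x)"
    have "c' \<in> E"
      using c x(1) i(1) by (auto simp: E_def c'_def PiE_def extensional_def)
    have "c ` J = c' ` J"
      using i(2) by (auto simp: c'_def intro!: image_cong)
    then have p': "p \<in> convex hull (c' ` I)"
      using S''(3) J(1,3) hull_mono[of "c' ` J" "c' ` I" convex] by auto
    have x': "x \<in> convex hull (c' ` I)"
      using i(1) by (intro hull_inc) (auto simp: c'_def)
    \<comment> \<open>The directions from \<open>p\<close> to \<open>0\<close> and to
      \<open>x\<close> form an acute angle, so a short move towards \<open>x\<close> comes closer to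
      \<open>0\<close> while staying in the hull for \<open>c'\<close>.\<close>
    have "inner (0 - p) (x - p) > 0"
      using x(2) pp by (simp only: diff_0 inner_minus_left inner_diff_right)
    then obtain u where u: "0 < u" "u \<le> 1" "norm (p + u *\<^sub>R (x - p)) < norm p"
      using closer_point_lemma[of 0 p x] by auto
    have "(1 - u) *\<^sub>R p + u *\<^sub>R x \<in> convex hull (c' ` I)"
      using u by (intro convexD_alt[OF convex_convex_hull p' x']) auto
    then have "d c' \<le> norm ((1 - u) *\<^sub>R p + u *\<^sub>R x)"
      unfolding d_def by (metis infdist_le dist_0_norm)
    also have "\<dots> < norm p"
      using u(3) by (simp add: algebra_simps)
    finally show False
      using min[OF \<open>c' \<in> E\<close>] d_c by simp
  qed
  with p that c show ?thesis
    by (auto simp: K_def E_def PiE_def Pi_def)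
qed

text \<open>The coordinate \<open>r0\<close> is determined by the others, so the differences of axis
  vectors in \<open>W\<close> span.\<close>

lemma dim_sum_zero_le:
  "dim {x :: 'a::euclidean_space^'k. (\<Sum>r\<in>UNIV. x $ r) = 0} \<le> (CARD('k) - 1) * DIM('a)"
proof -
  obtain r0 :: 'k where True
    by simp
  define W where "W = (\<lambda>(r, e). axis r e - axis r0 e) ` ((UNIV - {r0}) \<times> (Basis :: 'a set))"
  have "{x. (\<Sum>r\<in>UNIV. x $ r) = 0} \<subseteq> span W"
  proof safe
    fix x :: "'a^'k"
    assume x: "(\<Sum>r\<in>UNIV. x $ r) = 0"
    have ax: "axis r y = (\<Sum>e\<in>Basis. inner y e *\<^sub>R axis r e)" for r :: 'k and y :: 'a
      by (auto simp: vec_eq_iff axis_def euclidean_representation)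
    have in_span: "axis r y - axis r0 y \<in> span W" if "r \<noteq> r0" for r y
      unfolding ax[of _ y] sum_subtractf[symmetric] scaleR_diff_right[symmetric]
      using that by (intro span_sum span_scale span_base) (auto simp: W_def)
    have "x $ r0 = - (\<Sum>r\<in>UNIV - {r0}. x $ r)"
      using x by (simp add: sum.remove[of UNIV r0] eq_neg_iff_add_eq_0)
    then have "x = (\<Sum>r\<in>UNIV - {r0}. axis r (x $ r) - axis r0 (x $ r))"
      by (auto simp: vec_eq_iff axis_def sum_subtractf sum_negf if_distrib cong: if_cong)
    also have "\<dots> \<in> span W"
      by (intro span_sum in_span) auto
    finally show "x \<in> span W" .
  qed
  then have "dim {x :: 'a^'k. (\<Sum>r\<in>UNIV. x $ r) = 0} \<le> card W"
    by (rule dim_le_card) (simp add: W_def)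
  also have "\<dots> \<le> (CARD('k) - 1) * DIM('a)"
    unfolding W_def by (rule order_trans[OF card_image_le]) (auto simp: card_cartesian_product)
  finally show ?thesis .
qed

text \<open>\<open>s\<close> is the partition into blocks and \<open>z\<close> the common point.
  Weights in place of hulls allow coinciding points and later serve as squared coefficients. The
  bound on \<open>card I\<close> is the dimension of the \<open>'k\<close>-tuples of lifted vectors
  with sum \<open>0\<close>.\<close>

lemma tverberg_weights:
  fixes a :: "'i \<Rightarrow> 'a::euclidean_space"
  assumes "finite I" and card: "card I > (CARD('k::finite) - 1) * (DIM('a) + 1)"
  obtains s :: "'i \<Rightarrow> 'k::finite" and w z where "\<And>i. i \<in> I \<Longrightarrow> 0 \<le> w i"
    "\<And>t. (\<Sum>i | i \<in> I \<and> s i = t. w i) = 1"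
    "\<And>t. (\<Sum>i | i \<in> I \<and> s i = t. w i *\<^sub>R a i) = z"
proof -
  define K where "K = real CARD('k)"
  have K: "K > 0"
    by (simp add: K_def)
  \<comment> \<open>Tensor each lifted point \<open>(a i, 1)\<close> with the \<open>t\<close>-th vertex of a simplex centred at \<open>0\<close>, whose
    vertices satisfy no linear relation other than that their sum is \<open>0\<close>.\<close>
  define b :: "'i \<Rightarrow> 'k \<Rightarrow> ('a \<times> real)^'k"
    where "b i t = (\<chi> r. (of_bool (r = t) - 1 / K) *\<^sub>R (a i, 1))" for i t
  have hull: "0 \<in> convex hull (range (b i))" for i
  proof -
    have "(\<Sum>t\<in>UNIV. (1 / K) *\<^sub>R b i t) \<in> convex hull (range (b i))"
      by (rule convex_sum) (auto simp: K_def hull_inc)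
    moreover have "(\<Sum>t\<in>UNIV. b i t) = 0"
    proof -
      have "(\<Sum>t\<in>UNIV. b i t) $ r = (\<Sum>t\<in>UNIV. of_bool (r = t) - 1 / K) *\<^sub>R (a i, 1)" for r
        by (simp only: b_def sum_component vec_lambda_beta scaleR_sum_left)
      moreover have "(\<Sum>t\<in>UNIV. of_bool (r = t) - 1 / K) = 0" for r :: 'k
        using K by (simp add: sum_subtractf K_def of_bool_def)
      ultimately show ?thesis
        by (simp add: vec_eq_iff zero_prod_def)
    qed
    then have "(\<Sum>t\<in>UNIV. (1 / K) *\<^sub>R b i t) = 0"
      by (simp flip: scaleR_sum_right)
    ultimately show ?thesis
      by simp
  qed
  have "(\<Sum>r\<in>UNIV. b i t $ r) = 0" for i t
  proof -
    have "(\<Sum>r\<in>UNIV. of_bool (r = t) - 1 / K) = 0"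
      using K by (simp add: sum_subtractf K_def of_bool_def)
    moreover have "(\<Sum>r\<in>UNIV. b i t $ r) = (\<Sum>r\<in>UNIV. of_bool (r = t) - 1 / K) *\<^sub>R (a i, 1)"
      by (simp only: b_def vec_lambda_beta scaleR_sum_left)
    ultimately show ?thesis
      by (simp add: zero_prod_def)
  qed
  then have "dim (\<Union>i\<in>I. range (b i)) \<le> dim {x :: ('a \<times> real)^'k. (\<Sum>r\<in>UNIV. x $ r) = 0}"
    by (intro dim_subset) auto
  also have "\<dots> \<le> (CARD('k) - 1) * (DIM('a) + 1)"
    using dim_sum_zero_le[where ?'a = "'a \<times> real" and ?'k = 'k] by simp
  finally have "dim (\<Union>i\<in>I. range (b i)) < card I"
    using card by simp
  then obtain c where c: "\<And>i. i \<in> I \<Longrightarrow> c i \<in> range (b i)" "0 \<in> convex hull (c ` I)"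
    using colourful_caratheodory[OF assms(1), of "\<lambda>i. range (b i)"] hull by auto
  define s where "s i = (SOME t. c i = b i t)" for i
  have c_s: "c i = b i (s i)" if "i \<in> I" for i
    using c(1)[OF that] unfolding s_def by (auto intro: someI)
  obtain w where w: "\<And>i. i \<in> I \<Longrightarrow> 0 \<le> w i" "sum w I = 1" "(\<Sum>i\<in>I. w i *\<^sub>R c i) = 0"
    using convex_hull_image_weights[OF assms(1) c(2)] by metis
  define y where "y i = (a i, 1::real)" for i
  \<comment> \<open>Component \<open>t\<close> of the vanishing combination says that block
    \<open>t\<close> carries the share \<open>1 / K\<close> of the total, whatever \<open>t\<close>
    is.\<close>
  have part: "(\<Sum>i | i \<in> I \<and> s i = t. w i *\<^sub>R y i) = (1 / K) *\<^sub>R (\<Sum>i\<in>I. w i *\<^sub>R y i)" for t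
  proof -
    have "0 = (\<Sum>i\<in>I. w i *\<^sub>R b i (s i)) $ t"
      using w(3) by (simp add: c_s cong: sum.cong)
    also have "\<dots> = (\<Sum>i\<in>I. (if s i = t then w i *\<^sub>R y i else 0) - (1 / K) *\<^sub>R w i *\<^sub>R y i)"
      unfolding sum_component
      by (intro sum.cong refl) (auto simp: b_def y_def zero_prod_def algebra_simps)
    finally show ?thesis
      using assms(1)
      by (simp add: sum_subtractf sum.If_cases scaleR_sum_right Int_def conj_commute)
  qed
  show ?thesis
  \<comment> \<open>The lifted coordinate \<open>1\<close> shows that each block has weight
    \<open>1 / K\<close>, hence the factor \<open>K\<close>.\<close>
  proof (rule that[of "\<lambda>i. K * w i" s "\<Sum>i\<in>I. w i *\<^sub>R a i"])
    fix t
    have "(\<Sum>i | i \<in> I \<and> s i = t. w i) = 1 / K"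
      using arg_cong[OF part[of t], of snd] w(2) by (simp add: y_def snd_sum)
    then show "(\<Sum>i | i \<in> I \<and> s i = t. K * w i) = 1"
      using K by (simp flip: sum_distrib_left)
    have "(\<Sum>i | i \<in> I \<and> s i = t. w i *\<^sub>R a i) = (1 / K) *\<^sub>R (\<Sum>i\<in>I. w i *\<^sub>R a i)"
      using arg_cong[OF part[of t], of fst] by (simp add: y_def fst_sum)
    then show "(\<Sum>i | i \<in> I \<and> s i = t. (K * w i) *\<^sub>R a i) = (\<Sum>i\<in>I. w i *\<^sub>R a i)"
      unfolding scaleR_scaleR[symmetric] scaleR_sum_right[symmetric] using K by simp
  qed (use w(1) K in auto)
qed

section \<open>Eigenvectors in finite dimension\<close>

text \<open>This is \<open>p(T) v\<close>, evaluated by Horner's scheme.\<close>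

definition orbit_poly ::
    "('h::complex_hilbert_space \<Rightarrow> 'h) \<Rightarrow> 'h \<Rightarrow> complex poly \<Rightarrow> 'h" where
  "orbit_poly T v p = fold_coeffs (\<lambda>a w. a *\<^sub>C v + T w) p 0"

context
  fixes T :: "'h::complex_hilbert_space \<Rightarrow> 'h" and v :: 'h
  assumes T: "clinear T"
begin

interpretation T: Vector_Spaces.linear scaleC scaleC T
  by (rule T)

lemma orbit_poly_0: "orbit_poly T v 0 = 0"
  by (simp add: orbit_poly_def)

lemma orbit_poly_pCons: "orbit_poly T v (pCons a p) = a *\<^sub>C v + T (orbit_poly T v p)"
  by (cases "a = 0 \<and> p = 0") (auto simp: orbit_poly_def T.zero)

lemma orbit_poly_add: "orbit_poly T v (p + q) = orbit_poly T v p + orbit_poly T v q"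
  by (induction p q rule: poly_induct2)
    (simp_all add: orbit_poly_0 orbit_poly_pCons T.add scaleC_add_left algebra_simps)

lemma orbit_poly_smult: "orbit_poly T v (smult c p) = c *\<^sub>C orbit_poly T v p"
  by (induction p)
    (simp_all add: orbit_poly_0 orbit_poly_pCons T.scale scaleC_add_right scaleC_scaleC)

lemma orbit_poly_monom: "orbit_poly T v (monom c n) = c *\<^sub>C (T ^^ n) v"
  by (induction n)
    (simp_all add: monom_0 monom_Suc orbit_poly_0 orbit_poly_pCons T.scale T.zero)

text \<open>Degree below \<open>n\<close> is expressed by vanishing coefficients, which for
  \<open>n = 0\<close> leaves just the zero polynomial.\<close>

lemma span_orbit_poly:
  assumes "y \<in> cspan ((\<lambda>i. (T ^^ i) v) ` {..<n})"
  shows "\<exists>p. (\<forall>i\<ge>n. coeff p i = 0) \<and> orbit_poly T v p = y"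
  using assms
proof (induction n arbitrary: y)
  case 0
  then show ?case
    by (auto intro: exI[of _ 0] simp: orbit_poly_0)
next
  case (Suc n)
  then obtain k where "y - k *\<^sub>C (T ^^ n) v \<in> cspan ((\<lambda>i. (T ^^ i) v) ` {..<n})"
    by (auto simp: lessThan_Suc complex_vector.span_breakdown_eq)
  then obtain p where "\<forall>i\<ge>n. coeff p i = 0" "orbit_poly T v p = y - k *\<^sub>C (T ^^ n) v"
    using Suc.IH by blast
  then show ?case
    by (intro exI[of _ "p + monom k n"]) (simp add: orbit_poly_add orbit_poly_monom)
qed

text \<open>The orbit of \<open>v\<close> cannot stay independent in finite dimension, and a power
  depending on the earlier ones yields a monic annihilating polynomial.\<close>

lemma orbit_poly_eq_0_ex:
  assumes "finite S" "cspan S = (UNIV :: 'h set)"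
  shows "\<exists>p. p \<noteq> 0 \<and> orbit_poly T v p = 0"
proof -
  have "\<exists>n. (T ^^ n) v \<in> cspan ((\<lambda>i. (T ^^ i) v) ` {..<n})"
  proof (rule ccontr)
    assume no: "\<not> ?thesis"
    have "complex_vector.independent ((\<lambda>i. (T ^^ i) v) ` {..<n})
        \<and> card ((\<lambda>i. (T ^^ i) v) ` {..<n}) = n" for n
    proof (induction n)
      case 0
      then show ?case by (simp add: complex_vector.independent_empty)
    next
      case (Suc n)
      let ?O = "(\<lambda>i. (T ^^ i) v) ` {..<n}"
      have new: "(T ^^ n) v \<notin> cspan ?O"
        using no by blast
      then have "(T ^^ n) v \<notin> ?O"
        by (rule contrapos_nn) (rule complex_vector.span_base)
      then show ?case
        using Suc new complex_vector.independent_insertI[OF new]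
        by (simp only: lessThan_Suc image_insert) simp
    qed
    then have "complex_vector.independent ((\<lambda>i. (T ^^ i) v) ` {..<Suc (card S)})"
      and *: "card ((\<lambda>i. (T ^^ i) v) ` {..<Suc (card S)}) = Suc (card S)"
      by blast+
    from complex_vector.independent_span_bound[OF assms(1) this(1)] show False
      unfolding * assms(2) by simp
  qed
  then obtain n p where "\<forall>i\<ge>n. coeff p i = 0" "orbit_poly T v p = (T ^^ n) v"
    using span_orbit_poly by blast
  then have "orbit_poly T v (monom 1 n + smult (- 1) p) = 0" "coeff (monom 1 n + smult (- 1) p) n = 1"
    by (simp_all only: orbit_poly_add orbit_poly_monom orbit_poly_smult) simp_all
  then show ?thesis
    by (metis coeff_0 zero_neq_one)
qed

text \<open>Split a root \<open>z\<close> off an annihilating polynomial of least degree. The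
  cofactor \<open>q\<close> has too small a degree to annihilate \<open>v\<close>, so
  \<open>q(T) v\<close> is an eigenvector for \<open>z\<close>.\<close>

lemma eigenvector_ex:
  assumes "finite S" "cspan S = (UNIV :: 'h set)" "v \<noteq> 0"
  shows "\<exists>w z. norm w = 1 \<and> T w = z *\<^sub>C w"
proof -
  obtain p where p: "p \<noteq> 0" "orbit_poly T v p = 0"
    and min: "\<And>q. q \<noteq> 0 \<Longrightarrow> orbit_poly T v q = 0 \<Longrightarrow> degree p \<le> degree q"
    using ex_has_least_nat[of "\<lambda>p. p \<noteq> 0 \<and> orbit_poly T v p = 0" _ degree]
      orbit_poly_eq_0_ex[OF assms(1,2)] by blast
  \<comment> \<open>A nonzero constant does not annihilate \<open>v\<close>, so \<open>p\<close> is
    not constant.\<close>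
  have "\<not> (\<exists>a l. a \<noteq> 0 \<and> l = 0 \<and> p = pCons a l)"
    using p(2) assms(3) by (auto simp: orbit_poly_pCons orbit_poly_0 T.zero)
  then obtain z where "poly p z = 0"
    using fundamental_theorem_of_algebra_alt by blast
  then obtain q where q: "p = [:- z, 1:] * q"
    unfolding poly_eq_0_iff_dvd by blast
  with p(1) have "q \<noteq> 0"
    by auto
  then have "degree q < degree p"
    unfolding q by (subst degree_mult_eq) auto
  define u where "u = orbit_poly T v q"
  have "u \<noteq> 0"
    using min[OF \<open>q \<noteq> 0\<close>] \<open>degree q < degree p\<close> by (auto simp: u_def)
  have "p = smult (- z) q + pCons 0 q"
    by (simp add: q)
  then have "(- z) *\<^sub>C u + T u = 0"
    using p(2) by (simp only: orbit_poly_add orbit_poly_smult orbit_poly_pCons u_def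
        complex_vector.scale_zero_left add_0)
  then have Tu: "T u = z *\<^sub>C u"
    by (simp add: add_eq_0_iff complex_vector.scale_minus_left)
  define w where "w = inverse (norm u) *\<^sub>R u"
  have "T w = z *\<^sub>C w"
    unfolding w_def scaleR_eq_scaleC T.scale Tu by (simp add: scaleC_scaleC mult.commute)
  moreover have "norm w = 1"
    using \<open>u \<noteq> 0\<close> by (simp add: w_def)
  ultimately show ?thesis
    by blast
qed

end

section \<open>Higher-rank numerical ranges are non-empty\<close>

text \<open>The span of \<open>F\<close> holds everything the next vector must be orthogonal to, and
  each step adds at most \<open>m + 1\<close> generators. The last of \<open>M > 0\<close> steps
  needs \<open>card F0 + (M - 1) * (m + 1) < K\<close>, which is \<open>card\<close> rearranged.
  \<open>F0\<close> is left free so that a good \<open>x0\<close> can save a generator.\<close>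

lemma orthogonal_chain_ex:
  fixes A :: "'m::finite \<Rightarrow> 'h::complex_hilbert_space \<Rightarrow> 'h"
  assumes x0: "norm x0 = 1" "x0 \<in> cspan F0" "\<And>j. A j x0 \<in> cspan F0" and F0: "finite F0"
    and K: "\<And>F::'h set. finite F \<Longrightarrow> card F < K \<Longrightarrow> cspan F \<noteq> UNIV"
    and card: "card F0 + M * (CARD('m) + 1) \<le> K + CARD('m)"
  obtains x :: "nat \<Rightarrow> 'h" where "\<And>i. i \<le> M \<Longrightarrow> norm (x i) = 1"
    "\<And>i l. i \<le> M \<Longrightarrow> l < i \<Longrightarrow> cinner (x l) (x i) = 0"
    "\<And>i l j. i \<le> M \<Longrightarrow> l < i \<Longrightarrow> cinner (A j (x l)) (x i) = 0"
proof -
  have "\<exists>x F. finite F \<and> card F \<le> card F0 + n * (CARD('m) + 1) \<and>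
      (\<forall>i\<le>n. norm (x i) = 1 \<and> x i \<in> cspan F \<and> (\<forall>j. A j (x i) \<in> cspan F) \<and>
        (\<forall>l<i. cinner (x l) (x i) = 0 \<and> (\<forall>j. cinner (A j (x l)) (x i) = 0)))" if "n \<le> M" for n
    using that
  proof (induction n)
    case 0
    show ?case
      using x0 F0 by (intro exI[of _ "\<lambda>_. x0"] exI[of _ F0]) auto
  next
    case (Suc n)
    then obtain x F where F: "finite F" "card F \<le> card F0 + n * (CARD('m) + 1)"
      and x: "\<forall>i\<le>n. norm (x i) = 1 \<and> x i \<in> cspan F \<and> (\<forall>j. A j (x i) \<in> cspan F) \<and>
        (\<forall>l<i. cinner (x l) (x i) = 0 \<and> (\<forall>j. cinner (A j (x l)) (x i) = 0))"
      by auto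
    have "Suc n * (CARD('m) + 1) \<le> M * (CARD('m) + 1)"
      using Suc.prems by (rule mult_le_mono1)
    then have "card F < K"
      using F(2) card by simp
    then obtain z where z: "norm z = 1" "\<And>f. f \<in> F \<Longrightarrow> cinner f z = 0"
      using orthogonal_unit_vector_ex[OF F(1) K[OF F(1)]] by blast
    have zF: "cinner g z = 0" if "g \<in> cspan F" for g
      by (rule cinner_span_eq_0[OF that z(2)])
    define G where "G = insert z (range (\<lambda>j. A j z))"
    have "card G \<le> CARD('m) + 1"
      unfolding G_def using card_insert_le_m1[of "CARD('m) + 1"] card_image_le[of UNIV "\<lambda>j. A j z"]
      by (simp add: card_insert_le_m1)
    then have FG: "finite (F \<union> G)" "card (F \<union> G) \<le> card F0 + Suc n * (CARD('m) + 1)"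
      using F card_Un_le[of F G] by (auto simp: G_def)
    have sub: "g \<in> cspan (F \<union> G)" if "g \<in> cspan F" for g
      using that complex_vector.span_mono[of F "F \<union> G"] by auto
    have G: "z \<in> cspan (F \<union> G)" "A j z \<in> cspan (F \<union> G)" for j
      by (auto simp: G_def intro!: complex_vector.span_base)
    show ?case
      using FG x z(1) zF sub G
      by (intro exI[of _ "x(Suc n := z)"] exI[of _ "F \<union> G"]) (auto simp: le_Suc_eq)
  qed
  from this[of M] obtain x where "\<forall>i\<le>M. norm (x i) = 1 \<and>
      (\<forall>l<i. cinner (x l) (x i) = 0 \<and> (\<forall>j. cinner (A j (x l)) (x i) = 0))"
    by blast
  then show ?thesis
    by (intro that[of x]) auto
qed

text \<open>Square roots make the weights enter linearly, and distinct blocks share no index. It is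
  applied with \<open>T\<close> the identity and with \<open>T\<close> each
  \<open>A j\<close>.\<close>

lemma cinner_block_sums:
  fixes x :: "'i \<Rightarrow> 'h::complex_hilbert_space" and s :: "'i \<Rightarrow> 'k"
  assumes "clinear T" "finite I" and w: "\<And>i. i \<in> I \<Longrightarrow> 0 \<le> w i"
    and T: "\<And>i l. i \<in> I \<Longrightarrow> l \<in> I \<Longrightarrow> cinner (x i) (T (x l)) = of_bool (i = l) * of_real (g i)"
  defines "y \<equiv> \<lambda>t. \<Sum>i | i \<in> I \<and> s i = t. complex_of_real (sqrt (w i)) *\<^sub>C x i"
  shows "cinner (y t) (T (y t')) = of_bool (t = t') * of_real (\<Sum>i | i \<in> I \<and> s i = t. w i * g i)"
proof -
  have "cinner (y t) (T (y t')) = (\<Sum>i | i \<in> I \<and> s i = t. cnj (complex_of_real (sqrt (w i))) *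
      (\<Sum>l | l \<in> I \<and> s l = t'. of_bool (i = l) * of_real (g i) * complex_of_real (sqrt (w l))))"
    unfolding y_def clinear_sum_scale[OF assms(1)] by (rule cinner_sum_sum) (simp add: T)
  also have "\<dots> = (\<Sum>i | i \<in> I \<and> s i = t. of_bool (t = t') * of_real (w i * g i))"
  proof (rule sum.cong[OF refl])
    fix i
    assume i: "i \<in> {i. i \<in> I \<and> s i = t}"
    have "(\<Sum>l | l \<in> I \<and> s l = t'. of_bool (i = l) * of_real (g i) * complex_of_real (sqrt (w l)))
        = (\<Sum>l | l \<in> I \<and> s l = t'. if i = l then of_real (g i) * complex_of_real (sqrt (w i)) else 0)"
      by (intro sum.cong) auto
    also have "\<dots> = of_bool (t = t') * (of_real (g i) * complex_of_real (sqrt (w i)))"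
      using i assms(2) by (simp add: sum.delta)
    finally show "cnj (complex_of_real (sqrt (w i))) * (\<Sum>l | l \<in> I \<and> s l = t'.
        of_bool (i = l) * of_real (g i) * complex_of_real (sqrt (w l)))
        = of_bool (t = t') * of_real (w i * g i)"
      using w[of i] i by (simp flip: of_real_mult)
  qed
  finally show ?thesis
    by (simp flip: sum_distrib_left)
qed

lemma clinear_id: "clinear (\<lambda>x. x)"
  by unfold_locales auto

text \<open>For \<open>k = 1\<close> the dimension bound would be \<open>0\<close> and admit the
  zero space, where the range is empty.\<close>

lemma rank_numerical_range_nonempty:
  fixes A :: "'m::finite \<Rightarrow> 'h::complex_hilbert_space \<Rightarrow> 'h"
  assumes A: "\<And>j. selfadjoint (A j)" and k: "CARD('k::finite) \<ge> 2"
    and dim: "cdim_at_least TYPE('h) ((CARD('k) - 1) * (CARD('m) + 1)\<^sup>2)"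
  shows "rank_numerical_range TYPE('k) A \<noteq> {}"
proof -
  define M where "M = (CARD('k) - 1) * (CARD('m) + 1)"
  obtain x :: "nat \<Rightarrow> 'h" where x: "\<And>i. i \<le> M \<Longrightarrow> norm (x i) = 1"
    "\<And>i l. i \<le> M \<Longrightarrow> l < i \<Longrightarrow> cinner (x l) (x i) = 0"
    "\<And>i l j. i \<le> M \<Longrightarrow> l < i \<Longrightarrow> cinner (A j (x l)) (x i) = 0"
  proof (cases "\<exists>S :: 'h set. finite S \<and> cspan S = UNIV")
    case True
    then obtain S :: "'h set" where S: "finite S" "cspan S = UNIV"
      by blast
    have K: "cspan F \<noteq> UNIV" if "finite F" "card F < M * (CARD('m) + 1)" for F :: "'h set"
    proof
      assume "cspan F = UNIV"
      then have "cdim (UNIV :: 'h set) \<le> card F"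
        using that(1) by (intro complex_vector.dim_le_card) auto
      moreover have "M * (CARD('m) + 1) \<le> cdim (UNIV :: 'h set)"
        using dim True unfolding cdim_at_least_def M_def power2_eq_square mult.assoc by blast
      ultimately show False
        using that(2) by linarith
    qed
    have "M > 0"
      using k by (simp add: M_def)
    then have "cspan {} \<noteq> (UNIV :: 'h set)"
      by (intro K) auto
    then obtain v :: 'h where "v \<noteq> 0"
      by (auto simp: complex_vector.span_empty)
    obtain j0 :: 'm where True
      by simp
    obtain w z where w: "norm w = 1" "A j0 w = z *\<^sub>C w"
      using eigenvector_ex[OF selfadjoint_clinear[OF A[of j0]] S \<open>v \<noteq> 0\<close>] by blast
    \<comment> \<open>\<open>A j0 w\<close> is a multiple of \<open>w\<close> and is left out, so
      \<open>F0\<close> has at most \<open>m\<close> elements, just what the count allows for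
      \<open>K = M * (m + 1)\<close>.\<close>
    define F0 where "F0 = insert w ((\<lambda>j. A j w) ` (UNIV - {j0}))"
    have "card ((\<lambda>j. A j w) ` (UNIV - {j0})) \<le> CARD('m) - 1"
      by (rule order_trans[OF card_image_le]) (auto simp: card_Diff_singleton)
    then have "card F0 \<le> CARD('m)"
      unfolding F0_def by (rule card_insert_le_m1[OF zero_less_card_finite])
    have base: "w \<in> cspan F0"
      by (simp add: F0_def complex_vector.span_base)
    have "A j w \<in> cspan F0" for j
    proof (cases "j = j0")
      case True
      then show ?thesis
        using base w(2) by (simp add: complex_vector.span_scale)
    qed (auto simp: F0_def intro!: complex_vector.span_base)
    moreover have "finite F0"
      by (simp add: F0_def)
    ultimately show ?thesis
    proof (rule orthogonal_chain_ex[OF w(1) base, where A = A and M = M])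
      show "card F0 + M * (CARD('m) + 1) \<le> M * (CARD('m) + 1) + CARD('m)"
        using \<open>card F0 \<le> CARD('m)\<close> by simp
    qed (fact K, rule that)
  next
    case False
    then have K: "cspan F \<noteq> UNIV" if "finite F" for F :: "'h set"
      using that by blast
    obtain w :: 'h where w: "norm w = 1"
      using orthogonal_unit_vector_ex[OF _ K[of "{}"]] by auto
    define F0 where "F0 = insert w (range (\<lambda>j. A j w))"
    have "w \<in> cspan F0" "A j w \<in> cspan F0" for j
      by (auto simp: F0_def intro!: complex_vector.span_base)
    moreover have "finite F0"
      by (simp add: F0_def)
    ultimately show ?thesis
    proof (rule orthogonal_chain_ex[OF w, where A = A and M = M])
      show "card F0 + M * (CARD('m) + 1) \<le> (card F0 + M * (CARD('m) + 1)) + CARD('m)"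
        by simp
    qed (rule K, assumption, rule that)
  qed
  have orth: "cinner (x i) (x l) = of_bool (i = l) * of_real 1"
    if "i \<in> {..M}" "l \<in> {..M}" for i l
  proof (cases i l rule: linorder_cases)
    case less
    then show ?thesis
      using x(2)[of l i] that by simp
  next
    case equal
    then show ?thesis
      using x(1)[of i] that by (simp add: cinner_self)
  next
    case greater
    then have "cinner (x l) (x i) = 0"
      using x(2)[of i l] that by simp
    then have "cinner (x i) (x l) = 0"
      using cinner_eq_0_sym by blast
    with greater show ?thesis
      by simp
  qed
  \<comment> \<open>Diagonal entries of self-adjoint operators are real, so the real inner product
    loses nothing and Tverberg's theorem applies in \<open>real^'m\<close>.\<close>
  define a :: "nat \<Rightarrow> real^'m" where "a i = (\<chi> j. inner (x i) (A j (x i)))" for i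
  have orthA: "cinner (x i) (A j (x l)) = of_bool (i = l) * of_real (a i $ j)"
    if il: "i \<in> {..M}" "l \<in> {..M}" for i l j
  proof (cases i l rule: linorder_cases)
    case less
    then show ?thesis
      using x(3)[of l i j] il selfadjoint_cinner[OF A, of j "x i" "x l"] by simp
  next
    case equal
    have "cnj (cinner (x i) (A j (x i))) = cinner (x i) (A j (x i))"
      using selfadjoint_cinner[OF A] cinner_commute by metis
    then have "Im (cinner (x i) (A j (x i))) = 0"
      by (metis Reals_cnj_iff complex_is_Real_iff)
    then show ?thesis
      using equal by (simp add: complex_eq_iff Re_cinner a_def)
  next
    case greater
    then have "cinner (A j (x l)) (x i) = 0"
      using x(3)[of i l j] il by simp
    then have "cinner (x i) (A j (x l)) = 0"
      using cinner_eq_0_sym by blast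
    with greater show ?thesis
      by simp
  qed
  have "card {..M} > (CARD('k) - 1) * (DIM(real^'m) + 1)"
    by (simp add: M_def)
  then obtain s :: "nat \<Rightarrow> 'k" and w z where w: "\<And>i. i \<in> {..M} \<Longrightarrow> 0 \<le> w i"
    "\<And>t. (\<Sum>i | i \<in> {..M} \<and> s i = t. w i) = 1"
    "\<And>t. (\<Sum>i | i \<in> {..M} \<and> s i = t. w i *\<^sub>R a i) = z"
    by (rule tverberg_weights[OF finite_atMost, where a = a]) (rule that)
  \<comment> \<open>Block weights summing to \<open>1\<close> make each \<open>y t\<close> a unit
    vector, and the common point \<open>z\<close> makes its diagonal entries independent of
    \<open>t\<close>.\<close>
  define y where "y t = (\<Sum>i | i \<in> {..M} \<and> s i = t. complex_of_real (sqrt (w i)) *\<^sub>C x i)" for t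
  have "cinner (y t) (y t') = of_bool (t = t') * of_real (\<Sum>i | i \<in> {..M} \<and> s i = t. w i * 1)" for t t'
    unfolding y_def by (rule cinner_block_sums[OF clinear_id finite_atMost]; rule w(1) orth)
  then have "cinner (y t) (y t') = of_bool (t = t')" for t t'
    unfolding mult_1_right w(2) by simp
  moreover have "cinner (y t) (A j (y t')) = of_bool (t = t') * of_real (z $ j)" for j t t'
  proof -
    have "(\<Sum>i | i \<in> {..M} \<and> s i = t. w i * a i $ j) = z $ j"
      unfolding w(3)[of t, symmetric] sum_component by simp
    moreover have "cinner (y t) (A j (y t'))
        = of_bool (t = t') * of_real (\<Sum>i | i \<in> {..M} \<and> s i = t. w i * a i $ j)"
      unfolding y_def
      by (rule cinner_block_sums[OF selfadjoint_clinear[OF A] finite_atMost]; rule w(1) orthA)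
    ultimately show ?thesis
      by metis
  qed
  ultimately have "(\<chi> j. of_real (z $ j)) \<in> rank_numerical_range TYPE('k) A"
    unfolding rank_numerical_range_iff[OF selfadjoint_clinear[OF A]] orthonormal_family_def
    by (intro exI[of _ y]) simp
  then show ?thesis
    by blast
qed

section \<open>Star-shapedness\<close>

text \<open>A scalar compression stays scalar on every subspace, so any orthonormal family in the
  span realises \<open>c\<close> too, and the surplus dimensions absorb the conditions from
  \<open>F\<close>.\<close>

lemma rank_numerical_range_subfamily:
  fixes A :: "'m::finite \<Rightarrow> 'h::complex_hilbert_space \<Rightarrow> 'h"
  assumes A: "\<And>j. clinear (A j)" and c: "c \<in> rank_numerical_range TYPE('k::finite) A"
    and F: "finite F" "card F + CARD('n::finite) \<le> CARD('k)"
  obtains z :: "'n::finite \<Rightarrow> 'h" where "orthonormal_family z"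
    "\<And>j a b. cinner (z a) (A j (z b)) = of_bool (a = b) * c $ j"
    "\<And>f a. f \<in> F \<Longrightarrow> cinner f (z a) = 0"
proof -
  obtain u :: "'k \<Rightarrow> 'h" where u: "orthonormal_family u"
      "\<And>j a b. cinner (u a) (A j (u b)) = of_bool (a = b) * c $ j"
    using c by (auto simp: rank_numerical_range_iff[OF A])
  have "card (range u) = CARD('k)"
    by (simp add: card_image orthonormal_independent[OF u(1)])
  then obtain z :: "'n \<Rightarrow> 'h" where z: "orthonormal_family z" "\<And>a. z a \<in> cspan (range u)"
      "\<And>f a. f \<in> F \<Longrightarrow> cinner f (z a) = 0"
    using orthonormal_family_in_span_ex[OF F(1) _ orthonormal_independent(2)[OF u(1)]] F(2)
    by (metis finite finite_imageI)
  have "cinner (z a) (A j (z b)) = of_bool (a = b) * c $ j" for a b j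
  proof -
    interpret Aj: Vector_Spaces.linear scaleC scaleC "A j"
      by (rule A)
    \<comment> \<open>On the span, \<open>A j\<close> is multiplication by \<open>c $ j\<close> up
      to a vector orthogonal to the span.\<close>
    have "cinner (u t) (A j y - c $ j *\<^sub>C y) = 0" if "y \<in> cspan (range u)" for t y
      using that
    proof (induction rule: complex_vector.span_induct_alt)
      case base
      then show ?case by (simp add: Aj.zero)
    next
      case (step d x y)
      then obtain r where x: "x = u r" by auto
      from step(2) show ?case
        using u by (simp add: x Aj.add Aj.scale cinner_diff_right cinner_add_right
            cinner_scaleC_right orthonormal_family_def algebra_simps)
    qed
    then have "cinner (z a) (A j (z b) - c $ j *\<^sub>C z b) = 0"
      by (intro cinner_span_eq_0[OF z(2)]) (auto simp: z(2))
    then show ?thesis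
      using z(1) by (simp add: orthonormal_family_def cinner_diff_right cinner_scaleC_right)
  qed
  with z that show ?thesis
    by blast
qed

lemma scalar_tuple_entry:
  "of_bool (fst a = fst b) * scalar_tuple c $ j $ snd a $ snd b = of_bool (a = b) * c $ j"
  by (auto simp: scalar_tuple_def mat_def prod_eq_iff)

lemma star_center_matricial_range:
  fixes A :: "'m::finite \<Rightarrow> 'h::complex_hilbert_space \<Rightarrow> 'h"
  assumes A: "\<And>j. selfadjoint (A j)"
    and k: "CARD('p::finite) * CARD('q::finite) * (CARD('m) + 2) \<le> CARD('k::finite)"
    and c: "c \<in> rank_numerical_range TYPE('k) A"
  shows "star_center (matricial_range TYPE('p) A) (scalar_tuple c :: complex^'q^'q^'m)"
  unfolding star_center_def
proof (intro conjI ballI subsetI)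
  note lin = selfadjoint_clinear[OF A]
  have "card {} + CARD('p \<times> 'q) \<le> CARD('k)"
    using k by simp
  from rank_numerical_range_subfamily[OF lin c finite.emptyI this]
  show "(scalar_tuple c :: complex^'q^'q^'m) \<in> matricial_range TYPE('p) A"
    unfolding matricial_range_iff[OF lin] scalar_tuple_entry by metis
  fix B D :: "complex^'q^'q^'m"
  assume B: "B \<in> matricial_range TYPE('p) A"
  obtain y :: "'p \<times> 'q \<Rightarrow> 'h" where y: "\<And>a b. cinner (y a) (y b) = of_bool (a = b)"
    "\<And>j a b. cinner (y a) (A j (y b)) = of_bool (fst a = fst b) * B $ j $ snd a $ snd b"
    using B unfolding matricial_range_iff[OF lin] orthonormal_family_def by blast
  assume "D \<in> closed_segment (scalar_tuple c) B"
  then obtain u where u: "0 \<le> u" "u \<le> 1" and D: "D = (1 - u) *\<^sub>R scalar_tuple c + u *\<^sub>R B"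
    by (auto simp: in_segment)
  \<comment> \<open>With the images \<open>A j (y a)\<close> included, self-adjointness makes the
    mixed terms vanish on both sides.\<close>
  define F where "F = range y \<union> (\<lambda>(j, a). A j (y a)) ` UNIV"
  have "card F \<le> card (range y) + card ((\<lambda>(j, a). A j (y a)) ` UNIV)"
    unfolding F_def by (rule card_Un_le)
  also have "\<dots> \<le> CARD('p \<times> 'q) + CARD('m \<times> 'p \<times> 'q)"
    by (intro add_mono card_image_le finite)
  finally have "card F + CARD('p \<times> 'q) \<le> CARD('k)"
    using k by (simp add: algebra_simps)
  moreover have "finite F"
    by (simp add: F_def)
  ultimately obtain z :: "'p \<times> 'q \<Rightarrow> 'h" where z: "\<And>a b. cinner (z a) (z b) = of_bool (a = b)"
    "\<And>j a b. cinner (z a) (A j (z b)) = of_bool (a = b) * c $ j"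
    "\<And>f a. f \<in> F \<Longrightarrow> cinner f (z a) = 0"
    using rank_numerical_range_subfamily[OF lin c, of F, where ?'n = "'p \<times> 'q"]
    by (metis orthonormal_family_def)
  have cross: "cinner (y a) (z b) = 0" "cinner (z b) (y a) = 0"
    "cinner (y a) (A j (z b)) = 0" "cinner (z b) (A j (y a)) = 0" for a b j
  proof -
    have "y a \<in> F" "A j (y a) \<in> F"
      by (auto simp: F_def intro: rev_image_eqI[of "(j, a)"])
    then show "cinner (y a) (z b) = 0" "cinner (z b) (A j (y a)) = 0"
      using z(3) cinner_eq_0_sym by blast+
    then show "cinner (z b) (y a) = 0" "cinner (y a) (A j (z b)) = 0"
      using cinner_eq_0_sym selfadjoint_cinner[OF A] by metis+
  qed
  \<comment> \<open>Without cross terms, the compressions of \<open>z\<close> and \<open>y\<close>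
    enter with the squared coefficients \<open>1 - u\<close> and \<open>u\<close>.\<close>
  define w where "w a = complex_of_real (sqrt (1 - u)) *\<^sub>C z a + complex_of_real (sqrt u) *\<^sub>C y a" for a
  have sq: "complex_of_real (sqrt r) * (complex_of_real (sqrt r) * d) = of_real r * d"
    if "0 \<le> r" for r d
    using that by (simp flip: mult.assoc of_real_mult)
  have "cinner (w a) (w b) = of_bool (a = b)" for a b
    using u by (simp add: w_def cinner_add_left cinner_add_right cinner_scaleC_left
        cinner_scaleC_right cross y z sq)
  moreover have "cinner (w a) (A j (w b)) = of_bool (fst a = fst b) * D $ j $ snd a $ snd b" for a b j
  proof -
    interpret Aj: Vector_Spaces.linear scaleC scaleC "A j"
      by (rule lin)
    have "cinner (w a) (A j (w b)) = of_real (1 - u) * (of_bool (a = b) * c $ j)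
        + of_real u * (of_bool (fst a = fst b) * B $ j $ snd a $ snd b)"
      using u by (simp add: w_def Aj.add Aj.scale cinner_add_left cinner_add_right
          cinner_scaleC_left cinner_scaleC_right cross y z sq)
    also have "\<dots> = of_bool (fst a = fst b) * D $ j $ snd a $ snd b"
      unfolding scalar_tuple_entry[symmetric] D vector_add_component vector_scaleR_component
      unfolding scaleR_conv_of_real by (simp add: algebra_simps)
    finally show ?thesis .
  qed
  ultimately show "D \<in> matricial_range TYPE('p) A"
    unfolding matricial_range_iff[OF lin] orthonormal_family_def by blast
qed

text \<open>Needed because \<open>L\<close> is assumed affine only on Hermitian tuples.\<close>

lemma hermitian_matricial_range:
  fixes A :: "'m::finite \<Rightarrow> 'h::complex_hilbert_space \<Rightarrow> 'h" and B :: "complex^'q^'q^'m"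
  assumes A: "\<And>j. selfadjoint (A j)" and B: "B \<in> matricial_range TYPE('p::finite) A"
  shows "hermitian (B $ j)"
proof -
  obtain y :: "'p \<times> 'q \<Rightarrow> 'h" where
    y: "\<And>j a b. cinner (y a) (A j (y b)) = of_bool (fst a = fst b) * B $ j $ snd a $ snd b"
    using B unfolding matricial_range_iff[OF selfadjoint_clinear[OF A]] by blast
  \<comment> \<open>Fixing the first index reads off a single copy of \<open>B $ j\<close> from the
    block diagonal.\<close>
  obtain i :: 'p where True
    by simp
  have "B $ j $ a $ b = cnj (B $ j $ b $ a)" for a b
    using y[of "(i, a)" j "(i, b)"] y[of "(i, b)" j "(i, a)"] selfadjoint_cinner[OF A[of j]]
      cinner_commute[of "y (i, a)" "A j (y (i, b))"] by simp
  then show ?thesis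
    unfolding hermitian_def by blast
qed

text \<open>\<open>T\<close> is where \<open>L\<close> is affine. \<open>S\<close> need not be
  convex, but segments from the centre stay in it and are mapped to segments.\<close>

lemma star_center_affine_image:
  assumes "star_center S a" "S \<subseteq> T" "affine_map_on T L"
  shows "star_center (L ` S) (L a)"
proof -
  have "(1 - u) *\<^sub>R L a + u *\<^sub>R L x \<in> L ` S" if "x \<in> S" "0 \<le> u" "u \<le> 1" for x u
  proof -
    have "(1 - u) *\<^sub>R a + u *\<^sub>R x \<in> S"
      using assms(1) that by (auto simp: star_center_def in_segment subset_iff)
    moreover have "a \<in> T" "x \<in> T"
      using assms(1,2) that(1) by (auto simp: star_center_def)
    then have "L ((1 - u) *\<^sub>R a + u *\<^sub>R x) = (1 - u) *\<^sub>R L a + u *\<^sub>R L x"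
      using assms(3) by (simp add: affine_map_on_def)
    ultimately show ?thesis
      by (metis imageI)
  qed
  then show ?thesis
    using assms(1) by (auto simp: star_center_def in_segment)
qed

lemma star_center_imp_starlike: "star_center S a \<Longrightarrow> starlike S"
  by (auto simp: star_center_def starlike_def)

theorem theorem2p3:
  fixes A :: "'m::finite \<Rightarrow> 'h::complex_hilbert_space \<Rightarrow> 'h"
  assumes selfadj: "\<And>j. selfadjoint (A j)"
    and k: "CARD('k::finite) = CARD('p::finite) * CARD('q::finite) * (CARD('m) + 2)"
    and dim: "cdim_at_least TYPE('h)
      ((CARD('p) * CARD('q) * (CARD('m) + 2) - 1) * (CARD('m) + 1)\<^sup>2)"
  shows "rank_numerical_range TYPE('k) A \<noteq> {}
    \<and> (starlike (matricial_range TYPE('p) A :: (complex^'q^'q^'m) set)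
       \<and> (\<forall>c \<in> rank_numerical_range TYPE('k) A.
            star_center (matricial_range TYPE('p) A) (scalar_tuple c :: complex^'q^'q^'m)))
    \<and> (\<forall>L :: complex^'q^'q^'m \<Rightarrow> real^'r.
          affine_map_on {B. \<forall>j. hermitian (B $ j)} L \<longrightarrow>
          starlike (L ` matricial_range TYPE('p) A)
          \<and> (\<forall>c \<in> rank_numerical_range TYPE('k) A.
               star_center (L ` matricial_range TYPE('p) A) (L (scalar_tuple c))))"
proof -
  \<comment> \<open>Cardinalities of finite types are at least \<open>1\<close>, so \<open>k\<close>
    is at least \<open>3\<close>.\<close>
  have "1 * 1 * (1 + 2) \<le> CARD('p) * CARD('q) * (CARD('m) + 2)"
    by (intro mult_le_mono add_le_mono) (simp_all add: Suc_le_eq)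
  then have "CARD('k) \<ge> 2"
    using k by simp
  then have nonempty: "rank_numerical_range TYPE('k) A \<noteq> {}"
    using dim by (intro rank_numerical_range_nonempty selfadj) (simp_all add: k)
  have star: "star_center (matricial_range TYPE('p) A) (scalar_tuple c :: complex^'q^'q^'m)"
    if "c \<in> rank_numerical_range TYPE('k) A" for c
    using that by (intro star_center_matricial_range selfadj) (simp_all add: k)
  have image: "star_center (L ` matricial_range TYPE('p) A) (L (scalar_tuple c))"
    if "affine_map_on {B. \<forall>j. hermitian (B $ j)} L" "c \<in> rank_numerical_range TYPE('k) A"
    for L :: "complex^'q^'q^'m \<Rightarrow> real^'r" and c
    using hermitian_matricial_range[OF selfadj]
    by (intro star_center_affine_image[OF star[OF that(2)] _ that(1)]) auto
  \<comment> \<open>\<open>starlike\<close> asks for an actual centre, which non-emptiness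
    supplies.\<close>
  obtain c where c: "c \<in> rank_numerical_range TYPE('k) A"
    using nonempty by blast
  show ?thesis
    using nonempty star image star_center_imp_starlike[OF star[OF c]]
      star_center_imp_starlike[OF image[OF _ c]] by blast
qed

end
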